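(* Let $(G,w)$ be a weighted graph, $G=(V,E)$, $w:E\to[0,\infty)$. The following statements are equivalent. (i) The weight $w$ is metrizable. (ii) The equality $w(\{u,v\})=d_w(u,v)$ holds for all $\{u,v\}\in E$. (iii) For every cycle $C\subseteq G$ we have $2\max_{e\in E(C)}w(e)\leq w(C)$.
   Context: Graphs are simple, possibly infinite (the vertex set may have any cardinality); edges are two-element subsets of $V$. Paths and cycles are finite simple subgraphs. For a subgraph $F$ of $G$, $w(F):=\sum_{e\in E(F)}w(e)$. A pseudometric on $X$ is $d:X\times X\to[0,\infty)$ with $d(x,x)=0$, $d(x,y)=d(y,x)$, $d(x,y)\le d(x,z)+d(z,y)$. The weight $w$ is metrizable if there is a pseudometric $d$ on $V$ with $d(u,v)=w(\{u,v\})$ for all $\{u,v\}\in E$. For vertices $u,v$ in the same connected component, $d_w(u,v):=\inf\{w(F): F \text{ a path in } G \text{ joining } u \text{ and } v\}$ (the weighted shortest-path pseudometric). *)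

theory Defs
  imports Complex_Main
begin

type_synonym 'a graph = "'a set \<times> 'a set set"

abbreviation verts :: "'a graph \<Rightarrow> 'a set" where "verts \<equiv> fst"
abbreviation edges :: "'a graph \<Rightarrow> 'a set set" where "edges \<equiv> snd"

definition simple_graph :: "'a graph \<Rightarrow> bool" where
  "simple_graph G \<longleftrightarrow> (\<forall>e\<in>edges G. e \<subseteq> verts G \<and> card e = 2)"

text \<open>A weight is a total function on sets of vertices; only its values on the edges matter.\<close>

definition weighted_graph :: "'a graph \<Rightarrow> ('a set \<Rightarrow> real) \<Rightarrow> bool" where
  "weighted_graph G w \<longleftrightarrow> simple_graph G \<and> (\<forall>e\<in>edges G. 0 \<le> w e)"

definition subgraph :: "'a graph \<Rightarrow> 'a graph \<Rightarrow> bool" where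
  "subgraph F G \<longleftrightarrow> simple_graph F \<and> verts F \<subseteq> verts G \<and> edges F \<subseteq> edges G"

definition consecutive_pairs :: "'a list \<Rightarrow> 'a set set" where
  "consecutive_pairs xs = {{xs ! i, xs ! Suc i} | i. Suc i < length xs}"

text \<open>The one-vertex graph is a path joining its vertex to itself.\<close>

definition path_joining :: "'a \<Rightarrow> 'a \<Rightarrow> 'a graph \<Rightarrow> bool" where
  "path_joining u v F \<longleftrightarrow>
     (\<exists>xs. xs \<noteq> [] \<and> distinct xs \<and> hd xs = u \<and> last xs = v \<and>
           verts F = set xs \<and> edges F = consecutive_pairs xs)"

definition cycle :: "'a graph \<Rightarrow> bool" where
  "cycle F \<longleftrightarrow>
     (\<exists>xs. 3 \<le> length xs \<and> distinct xs \<and>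
           verts F = set xs \<and> edges F = insert {last xs, hd xs} (consecutive_pairs xs))"

text \<open>Used only for finite \<open>F\<close>; the sum would be \<open>0\<close> if \<open>F\<close> had infinitely many edges.\<close>

definition total_weight :: "('a set \<Rightarrow> real) \<Rightarrow> 'a graph \<Rightarrow> real" where
  "total_weight w F = (\<Sum>e\<in>edges F. w e)"

text \<open>Meaningful only for \<open>u\<close> and \<open>v\<close> in the same connected component; otherwise the infimum is
  taken over the empty set and its value is unspecified.\<close>

definition path_dist :: "'a graph \<Rightarrow> ('a set \<Rightarrow> real) \<Rightarrow> 'a \<Rightarrow> 'a \<Rightarrow> real" where
  "path_dist G w u v = Inf {total_weight w F | F. subgraph F G \<and> path_joining u v F}"

definition pseudometric_on :: "'a set \<Rightarrow> ('a \<Rightarrow> 'a \<Rightarrow> real) \<Rightarrow> bool" where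
  "pseudometric_on X d \<longleftrightarrow>
     (\<forall>x\<in>X. \<forall>y\<in>X. 0 \<le> d x y) \<and>
     (\<forall>x\<in>X. d x x = 0) \<and>
     (\<forall>x\<in>X. \<forall>y\<in>X. d x y = d y x) \<and>
     (\<forall>x\<in>X. \<forall>y\<in>X. \<forall>z\<in>X. d x y \<le> d x z + d z y)"

definition metrizable :: "'a graph \<Rightarrow> ('a set \<Rightarrow> real) \<Rightarrow> bool" where
  "metrizable G w \<longleftrightarrow>
     (\<exists>d. pseudometric_on (verts G) d \<and> (\<forall>u v. {u, v} \<in> edges G \<longrightarrow> d u v = w {u, v}))"

end

theory Submission
  imports Defs
begin

text \<open>
  A pseudometric extending the weight satisfies the polygon inequality along every path, in particular
  along the path that a cycle becomes when one of its heaviest edges is deleted; this gives (iii) from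
  (i). Conversely, an edge and a path joining its endpoints form a cycle (or the path is the edge
  itself), so (iii) bounds the weight of the edge by the weight of the path, which is (ii). Finally
  the shortest-path pseudometric lives on single components only; to get (i) from (ii), pick a root
  in each component and let the distance of points of different components be the sum of the distances
  to their roots.
\<close>

section \<open>Consecutive pairs of lists\<close>

lemma consecutive_pairs_Nil [simp]: "consecutive_pairs [] = {}"
  by (simp add: consecutive_pairs_def)

text \<open>Trades the indices of the definition for a recursion, on which the later list inductions
  rest.\<close>

lemma consecutive_pairs_Cons [simp]:
  "consecutive_pairs (x # xs) = (if xs = [] then {} else insert {x, hd xs} (consecutive_pairs xs))"
proof (cases xs)
  case (Cons y ys)
  have pairs: "consecutive_pairs (z # zs) =
      {e. \<exists>i<length zs. e = {(z # zs) ! i, zs ! i}}" for z :: 'a and zs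
    by (auto simp: consecutive_pairs_def)
  show ?thesis
    \<comment> \<open>\<open>Ex_less_Suc2\<close> splits off index 0, the pair of the first two
      entries; the other indices shift down by one.\<close>
    unfolding Cons pairs list.size add_Suc_right add_0_right Ex_less_Suc2 by auto
qed (simp add: consecutive_pairs_def)

lemma consecutive_pairs_subset: "e \<in> consecutive_pairs xs \<Longrightarrow> e \<subseteq> set xs"
  by (induction xs) (auto split: if_splits)

lemma finite_consecutive_pairs [simp]: "finite (consecutive_pairs xs)"
  by (induction xs) auto

lemma consecutive_pairs_append:
  assumes "xs \<noteq> []" "ys \<noteq> []"
  shows "consecutive_pairs (xs @ ys) =
    insert {last xs, hd ys} (consecutive_pairs xs \<union> consecutive_pairs ys)"
  using assms by (induction xs) (auto simp: hd_append)

lemma consecutive_pairs_rev: "consecutive_pairs (rev xs) = consecutive_pairs xs"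
  by (induction xs) (auto simp: consecutive_pairs_append last_rev insert_commute)

text \<open>By distinctness the head occurs in the first pair only, and its partner there, the
  second entry, is not the last one. With two entries the closing pair would repeat the only
  consecutive pair.\<close>

lemma closing_pair_notin_consecutive_pairs:
  assumes "3 \<le> length xs" "distinct xs"
  shows "{last xs, hd xs} \<notin> consecutive_pairs xs"
proof -
  obtain x y zs where xs: "xs = x # y # zs" and "zs \<noteq> []"
    using assms(1) by (cases xs; cases "tl xs"; cases "tl (tl xs)") auto
  define l where "l = last xs"
  have "l \<in> set zs"
    using \<open>zs \<noteq> []\<close> by (simp add: l_def xs)
  then have l: "l \<noteq> x" "l \<noteq> y"
    using assms(2) xs by auto
  have "{l, x} \<notin> consecutive_pairs (y # zs)"
    using consecutive_pairs_subset[of "{l, x}" "y # zs"] assms(2) unfolding xs by force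
  moreover have "{l, x} \<noteq> {x, y}"
    using l by blast
  ultimately show ?thesis
    unfolding l_def[symmetric] unfolding xs by simp
qed

section \<open>Edge sets of cycles and rotation\<close>

definition closed_pairs :: "'a list \<Rightarrow> 'a set set" where
  "closed_pairs xs = insert {last xs, hd xs} (consecutive_pairs xs)"

lemma closed_pairs_rotate1: "closed_pairs (rotate1 xs) = closed_pairs xs"
  by (cases xs) (auto simp: closed_pairs_def consecutive_pairs_append insert_commute)

lemma closed_pairs_rotate: "closed_pairs (rotate n xs) = closed_pairs xs"
  by (induction n) (simp_all add: closed_pairs_rotate1)

text \<open>Lets any edge of a cycle be taken as the closing one, so that deleting it leaves the
  path listed by the rotated list.\<close>

lemma closed_pairs_eq_rotated_closing_pair:
  assumes "e \<in> closed_pairs xs" "xs \<noteq> []"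
  obtains n where "e = {last (rotate n xs), hd (rotate n xs)}"
proof (cases "e = {last xs, hd xs}")
  case True
  then show thesis
    using that[of 0] by simp
next
  case False
  then obtain i where i: "Suc i < length xs" "e = {xs ! i, xs ! Suc i}"
    using assms by (auto simp: closed_pairs_def consecutive_pairs_def)
  \<comment> \<open>Rotation by \<open>Suc i\<close> cuts the list between the two entries of
    \<open>e\<close>: the later one comes first and the earlier one last.\<close>
  have "hd (rotate (Suc i) xs) = xs ! Suc i"
    using i by (cases "Suc i = length xs") (simp_all add: hd_rotate_conv_nth assms(2) del: rotate_Suc)
  moreover have "last (rotate (Suc i) xs) = xs ! i"
    using i assms(2)
    by (simp add: rotate_drop_take last_append last_conv_nth min_def del: rotate_Suc)
  ultimately show thesis
    using that[of "Suc i"] i by simp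
qed

section \<open>Walks and their weights\<close>

text \<open>Counts an edge as often as it is traversed, whereas \<open>total_weight\<close> sums
  over a set. This makes it additive under concatenation.\<close>

primrec walk_weight :: "('a set \<Rightarrow> real) \<Rightarrow> 'a list \<Rightarrow> real" where
  "walk_weight w [] = 0"
| "walk_weight w (x # xs) = (if xs = [] then 0 else w {x, hd xs} + walk_weight w xs)"

lemma walk_weight_append:
  assumes "xs \<noteq> []" "ys \<noteq> []"
  shows "walk_weight w (xs @ ys) = walk_weight w xs + w {last xs, hd ys} + walk_weight w ys"
  using assms by (induction xs) (auto simp: hd_append)

lemma walk_weight_rev: "walk_weight w (rev xs) = walk_weight w xs"
  by (induction xs) (auto simp: walk_weight_append last_rev insert_commute)

lemma walk_weight_nonneg:
  "(\<And>e. e \<in> consecutive_pairs xs \<Longrightarrow> 0 \<le> w e) \<Longrightarrow> 0 \<le> walk_weight w xs"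
  by (induction xs) (auto split: if_splits)

text \<open>In a distinct list the head is missing from all later pairs, so no edge is traversed
  twice.\<close>

lemma sum_consecutive_pairs:
  "distinct xs \<Longrightarrow> sum w (consecutive_pairs xs) = walk_weight w xs"
proof (induction xs)
  case (Cons x xs)
  then have "{x, hd xs} \<notin> consecutive_pairs xs"
    using consecutive_pairs_subset[of "{x, hd xs}" xs] by auto
  then show ?case
    using Cons by simp
qed simp

text \<open>Vertices may repeat, so that walks, unlike paths, can be concatenated.\<close>

definition walk :: "'a graph \<Rightarrow> 'a \<Rightarrow> 'a \<Rightarrow> 'a list \<Rightarrow> bool" where
  "walk G u v xs \<longleftrightarrow> xs \<noteq> [] \<and> hd xs = u \<and> last xs = v \<and>
     set xs \<subseteq> verts G \<and> consecutive_pairs xs \<subseteq> edges G"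

lemma walk_weight_nonneg_walk:
  "weighted_graph G w \<Longrightarrow> walk G u v xs \<Longrightarrow> 0 \<le> walk_weight w xs"
  by (rule walk_weight_nonneg) (auto simp: weighted_graph_def walk_def)

lemma walk_rev: "walk G u v xs \<Longrightarrow> walk G v u (rev xs)"
  by (simp add: walk_def hd_rev last_rev consecutive_pairs_rev)

lemma walk_single: "walk G u u [u] \<longleftrightarrow> u \<in> verts G"
  by (simp add: walk_def)

lemma walk_edge:
  "weighted_graph G w \<Longrightarrow> {u, v} \<in> edges G \<Longrightarrow> walk G u v [u, v]"
  by (auto simp: walk_def weighted_graph_def simple_graph_def)

lemma walk_concat:
  assumes "walk G u v xs" "walk G v x ys"
  obtains zs where "walk G u x zs" "walk_weight w zs = walk_weight w xs + walk_weight w ys"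
\<comment> \<open>The common vertex \<open>v\<close> ends \<open>xs\<close> and begins
  \<open>ys\<close>, so only the tail of \<open>ys\<close> is appended; if that is empty,
  \<open>xs\<close> itself serves.\<close>
proof (cases "tl ys = []")
  case True
  then have "ys = [v]" "x = v"
    using assms(2) by (cases ys; auto simp: walk_def)+
  then show thesis
    using that[of xs] assms(1) by simp
next
  case False
  then obtain zs where ys: "ys = v # zs" "zs \<noteq> []"
    using assms(2) by (cases ys) (auto simp: walk_def)
  then show thesis
    using that[of "xs @ zs"] assms
    by (auto simp: walk_def consecutive_pairs_append walk_weight_append)
qed

text \<open>Shortcutting: once the tail is a path, a first vertex that already lies on it cuts the
  path down to start there. The discarded edges have nonnegative weight.\<close>

lemma walk_to_path:
  assumes w: "weighted_graph G w" and "walk G u v xs"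
  obtains ys where "walk G u v ys" "distinct ys" "walk_weight w ys \<le> walk_weight w xs"
proof -
  have "\<exists>ys. walk G u v ys \<and> distinct ys \<and> walk_weight w ys \<le> walk_weight w xs"
    using assms(2)
  proof (induction xs arbitrary: u)
    case (Cons x xs)
    show ?case
    proof (cases "xs = []")
      case True
      then show ?thesis
        using Cons.prems by (intro exI[of _ "[x]"]) (auto simp: walk_def)
    next
      case False
      then have x: "x = u" "x \<in> verts G" "{x, hd xs} \<in> edges G" and "walk G (hd xs) v xs"
        using Cons.prems by (auto simp: walk_def)
      with Cons.IH obtain ys where ys: "walk G (hd xs) v ys" "distinct ys"
        "walk_weight w ys \<le> walk_weight w xs"
        by blast
      have we: "0 \<le> w {x, hd xs}"
        using w x by (simp add: weighted_graph_def)
      show ?thesis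
      proof (cases "x \<in> set ys")
        case True
        then obtain as bs where ab: "ys = as @ x # bs"
          by (meson split_list)
        have path: "walk G u v (x # bs)" "distinct (x # bs)"
          using ys x by (cases "as = []"; auto simp: ab walk_def consecutive_pairs_append)+
        have "walk_weight w (x # bs) \<le> walk_weight w ys"
        proof (cases "as = []")
          case False
          have "0 \<le> w e" if "e \<in> consecutive_pairs ys" for e
            using that ys w by (auto simp: walk_def weighted_graph_def)
          then have "0 \<le> walk_weight w as" "0 \<le> w {last as, x}"
            using False by (auto simp: ab consecutive_pairs_append intro!: walk_weight_nonneg)
          then show ?thesis
            using False by (simp add: ab walk_weight_append del: walk_weight.simps)
        qed (simp add: ab)
        then have "walk_weight w (x # bs) \<le> walk_weight w (x # xs)"
          using ys(3) we False by simp
        then show ?thesis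
          using path by blast
      next
        case False
        then show ?thesis
          using ys x \<open>xs \<noteq> []\<close> by (intro exI[of _ "x # ys"]) (auto simp: walk_def)
      qed
    qed
  qed (simp add: walk_def)
  then show thesis
    using that by blast
qed

section \<open>The shortest-path pseudometric\<close>

text \<open>Replaces path subgraphs by distinct vertex lists, so that the infimum can be handled by
  walks.\<close>

lemma path_weights_eq:
  assumes "weighted_graph G w"
  shows "{total_weight w F | F. subgraph F G \<and> path_joining u v F} =
    {walk_weight w xs | xs. walk G u v xs \<and> distinct xs}" (is "?A = ?B")
proof (intro equalityI subsetI)
  fix r assume "r \<in> ?A"
  then obtain F xs where "r = total_weight w F" "subgraph F G" "xs \<noteq> []" "distinct xs"
    "hd xs = u" "last xs = v" "verts F = set xs" "edges F = consecutive_pairs xs"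
    unfolding path_joining_def by blast
  then have "r = walk_weight w xs" "walk G u v xs" "distinct xs"
    by (auto simp: total_weight_def subgraph_def walk_def sum_consecutive_pairs)
  then show "r \<in> ?B"
    by blast
next
  fix r assume "r \<in> ?B"
  then obtain xs where xs: "r = walk_weight w xs" "walk G u v xs" "distinct xs"
    by blast
  let ?F = "(set xs, consecutive_pairs xs)"
  have "simple_graph ?F"
    using assms xs consecutive_pairs_subset[of _ xs]
    by (auto simp: weighted_graph_def simple_graph_def walk_def)
  then have "subgraph ?F G" "path_joining u v ?F" "r = total_weight w ?F"
    using xs by (auto simp: subgraph_def path_joining_def walk_def total_weight_def
        sum_consecutive_pairs)
  then show "r \<in> ?A"
    by blast
qed

text \<open>The infimum ranges over paths only; shortcutting extends the bound to walks.\<close>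

lemma path_dist_le_walk_weight:
  assumes "weighted_graph G w" "walk G u v xs"
  shows "path_dist G w u v \<le> walk_weight w xs"
proof -
  obtain ys where ys: "walk G u v ys" "distinct ys" "walk_weight w ys \<le> walk_weight w xs"
    using walk_to_path[OF assms] .
  have "path_dist G w u v \<le> walk_weight w ys"
    unfolding path_dist_def path_weights_eq[OF assms(1)]
  proof (rule cInf_lower)
    show "bdd_below {walk_weight w xs | xs. walk G u v xs \<and> distinct xs}"
      using walk_weight_nonneg_walk[OF assms(1)] by (intro bdd_belowI[of _ 0]) auto
  qed (use ys in blast)
  with ys(3) show ?thesis
    by simp
qed

text \<open>The given walk guarantees that some path exists, so the infimum is not over the empty
  set.\<close>

lemma path_dist_greatest:
  assumes "weighted_graph G w" "walk G u v xs"
    and "\<And>ys. walk G u v ys \<Longrightarrow> distinct ys \<Longrightarrow> c \<le> walk_weight w ys"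
  shows "c \<le> path_dist G w u v"
  unfolding path_dist_def path_weights_eq[OF assms(1)]
proof (rule cInf_greatest)
  obtain ys where "walk G u v ys" "distinct ys"
    using walk_to_path[OF assms(1,2)] .
  then show "{walk_weight w xs | xs. walk G u v xs \<and> distinct xs} \<noteq> {}"
    by blast
qed (use assms(3) in blast)

definition reachable :: "'a graph \<Rightarrow> 'a \<Rightarrow> 'a \<Rightarrow> bool" where
  "reachable G u v \<longleftrightarrow> (\<exists>xs. walk G u v xs)"

lemma reachable_refl: "u \<in> verts G \<Longrightarrow> reachable G u u"
  unfolding reachable_def by (blast intro: walk_single[THEN iffD2])

lemma reachable_sym: "reachable G u v \<Longrightarrow> reachable G v u"
  unfolding reachable_def by (blast intro: walk_rev)

lemma reachable_trans: "reachable G u v \<Longrightarrow> reachable G v x \<Longrightarrow> reachable G u x"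
  unfolding reachable_def by (meson walk_concat)

lemma path_dist_nonneg:
  assumes "weighted_graph G w" "reachable G u v"
  shows "0 \<le> path_dist G w u v"
proof -
  obtain xs where "walk G u v xs"
    using assms(2) unfolding reachable_def by blast
  then show ?thesis
    using walk_weight_nonneg_walk[OF assms(1)] by (intro path_dist_greatest[OF assms(1)]) blast+
qed

lemma path_dist_refl:
  assumes "weighted_graph G w" "u \<in> verts G"
  shows "path_dist G w u u = 0"
  using path_dist_le_walk_weight[OF assms(1), of u u "[u]"] path_dist_nonneg[OF assms(1), of u u]
    assms(2) by (simp add: walk_single reachable_refl)

lemma path_dist_sym:
  assumes "weighted_graph G w" "reachable G u v"
  shows "path_dist G w u v = path_dist G w v u"
proof -
  have "path_dist G w a b \<le> path_dist G w b a" if ba: "reachable G b a" for a b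
  proof -
    obtain xs where "walk G b a xs"
      using ba unfolding reachable_def by blast
    then show ?thesis
    proof (rule path_dist_greatest[OF assms(1)])
      fix ys assume "walk G b a ys"
      then show "path_dist G w a b \<le> walk_weight w ys"
        using path_dist_le_walk_weight[OF assms(1) walk_rev] by (simp add: walk_weight_rev)
    qed
  qed
  then show ?thesis
    using assms(2) reachable_sym by (metis order_antisym)
qed

lemma path_dist_triangle:
  assumes "weighted_graph G w" "reachable G u v" "reachable G v x"
  shows "path_dist G w u x \<le> path_dist G w u v + path_dist G w v x"
proof -
  obtain p q where p: "walk G u v p" and q: "walk G v x q"
    using assms by (auto simp: reachable_def)
  \<comment> \<open>In an infinite graph no path need attain the infimum. Hence the second leg is
    optimized for a fixed first leg \<open>xs\<close>, and only then \<open>xs\<close>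
    varies.\<close>
  have "path_dist G w u x - walk_weight w xs \<le> path_dist G w v x" if "walk G u v xs" for xs
  proof (rule path_dist_greatest[OF assms(1) q])
    fix ys assume "walk G v x ys"
    then obtain zs where "walk G u x zs" "walk_weight w zs = walk_weight w xs + walk_weight w ys"
      using walk_concat[OF \<open>walk G u v xs\<close>] by blast
    then show "path_dist G w u x - walk_weight w xs \<le> walk_weight w ys"
      using path_dist_le_walk_weight[OF assms(1)] by fastforce
  qed
  then have "path_dist G w u x - path_dist G w v x \<le> path_dist G w u v"
    by (intro path_dist_greatest[OF assms(1) p]) (simp add: algebra_simps)
  then show ?thesis
    by simp
qed

section \<open>Gluing the components at their roots: (ii) implies (i)\<close>

lemma metrizable_if_path_dist_extends:
  assumes w: "weighted_graph G w"
    and ext: "\<And>u v. {u, v} \<in> edges G \<Longrightarrow> w {u, v} = path_dist G w u v"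
  shows "metrizable G w"
proof -
  define root where "root u = (SOME v. reachable G u v)" for u
  have root: "reachable G u (root u)" if "u \<in> verts G" for u
    unfolding root_def using reachable_refl[OF that] by (rule someI)
  have root_eq: "root u = root v" if "reachable G u v" for u v
  proof -
    \<comment> \<open>\<open>SOME\<close> sees only the predicate \<open>reachable G u\<close>, so
      equal predicates yield the same root.\<close>
    have "reachable G u = reachable G v"
      using that by (blast intro: reachable_sym reachable_trans)
    then show ?thesis
      by (simp add: root_def)
  qed
  define h where "h u = path_dist G w u (root u)" for u
  \<comment> \<open>Since \<open>h\<close> vanishes at the roots, roots of different components get
    distance 0, which a pseudometric permits.\<close>
  define d where "d u v = (if reachable G u v then path_dist G w u v else h u + h v)" for u v
  have h_nonneg: "0 \<le> h u" if "u \<in> verts G" for u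
    using path_dist_nonneg[OF w root[OF that]] by (simp add: h_def)
  \<comment> \<open>For the triangle inequality when \<open>z\<close> shares a component with
    exactly one of \<open>x\<close> and \<open>y\<close>.\<close>
  have h_diff: "h u \<le> path_dist G w u v + h v" if "reachable G u v" "v \<in> verts G" for u v
    using path_dist_triangle[OF w that(1) root[OF that(2)]] root_eq[OF that(1)]
    by (simp add: h_def)
  \<comment> \<open>The detour through the common root; it serves when \<open>z\<close> is in the
    component of neither \<open>x\<close> nor \<open>y\<close>.\<close>
  have h_sum: "path_dist G w u v \<le> h u + h v"
    if "reachable G u v" "u \<in> verts G" "v \<in> verts G" for u v
    using path_dist_triangle[OF w root[OF that(2)], of v] path_dist_sym[OF w root[OF that(3)]]
      reachable_sym[OF root[OF that(3)]] root_eq[OF that(1)]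
    by (simp add: h_def)
  have sym: "d u v = d v u" for u v
    using path_dist_sym[OF w] by (auto simp: d_def reachable_sym)
  have "d x y \<le> d x z + d z y" if V: "x \<in> verts G" "y \<in> verts G" "z \<in> verts G" for x y z
  proof (cases "reachable G x z")
    case xz: True
    show ?thesis
    proof (cases "reachable G z y")
      case True
      then show ?thesis
        using xz path_dist_triangle[OF w xz True] reachable_trans[OF xz True] by (simp add: d_def)
    next
      case False
      then have "\<not> reachable G x y"
        using xz by (blast intro: reachable_sym reachable_trans)
      then show ?thesis
        using xz False h_diff[OF xz] V by (simp add: d_def)
    qed
  next
    case xz: False
    show ?thesis
    proof (cases "reachable G z y")
      case True
      then have "\<not> reachable G x y"
        using xz by (blast intro: reachable_sym reachable_trans)
      then show ?thesis
        using xz True h_diff[OF reachable_sym[OF True]] path_dist_sym[OF w True] V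
        by (simp add: d_def)
    next
      case False
      \<comment> \<open>Holds whether or not \<open>x\<close> and \<open>y\<close> share a
        component. The right-hand side of the goal exceeds this bound by
        \<open>2 * h z\<close>.\<close>
      have "d x y \<le> h x + h y"
        using h_sum V by (simp add: d_def)
      then show ?thesis
        using xz False h_nonneg[OF V(3)] by (simp add: d_def)
    qed
  qed
  moreover have "0 \<le> d x y" if "x \<in> verts G" "y \<in> verts G" for x y
    using that path_dist_nonneg[OF w] h_nonneg by (simp add: d_def)
  moreover have "d x x = 0" if "x \<in> verts G" for x
    using path_dist_refl[OF w that] reachable_refl[OF that] by (simp add: d_def)
  ultimately have "pseudometric_on (verts G) d"
    using sym unfolding pseudometric_on_def by blast
  moreover have "d u v = w {u, v}" if "{u, v} \<in> edges G" for u v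
  proof -
    have "reachable G u v"
      using walk_edge[OF w that] by (auto simp: reachable_def)
    then show ?thesis
      using ext[OF that] by (simp add: d_def)
  qed
  ultimately show ?thesis
    unfolding metrizable_def by blast
qed

section \<open>The polygon inequality and cycles: (i) implies (iii)\<close>

lemma pseudometric_le_walk_weight:
  assumes d: "pseudometric_on (verts G) d" "\<And>u v. {u, v} \<in> edges G \<Longrightarrow> d u v = w {u, v}"
    and "walk G u v xs"
  shows "d u v \<le> walk_weight w xs"
  using assms(3)
proof (induction xs arbitrary: u)
  case (Cons x xs)
  show ?case
  proof (cases "xs = []")
    case True
    then show ?thesis
      using Cons.prems d(1) by (auto simp: walk_def pseudometric_on_def)
  next
    case False
    then have x: "x = u" "x \<in> verts G" "hd xs \<in> verts G" "v \<in> verts G" "{x, hd xs} \<in> edges G"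
      and "walk G (hd xs) v xs"
      using Cons.prems by (auto simp: walk_def)
    then have "d (hd xs) v \<le> walk_weight w xs"
      using Cons.IH by blast
    moreover have "d x v \<le> d x (hd xs) + d (hd xs) v"
      using d(1) x unfolding pseudometric_on_def by blast
    ultimately show ?thesis
      using d(2) x False by simp
  qed
qed (simp add: walk_def)

lemma metrizable_imp_cycle_inequality:
  assumes "metrizable G w" "subgraph C G" "cycle C"
  shows "2 * Max (w ` edges C) \<le> total_weight w C"
proof -
  obtain d where d: "pseudometric_on (verts G) d" "\<And>u v. {u, v} \<in> edges G \<Longrightarrow> d u v = w {u, v}"
    using assms(1) unfolding metrizable_def by blast
  obtain xs where xs: "3 \<le> length xs" "distinct xs" "verts C = set xs" "edges C = closed_pairs xs"
    using assms(3) unfolding cycle_def closed_pairs_def by blast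
  \<comment> \<open>Every edge \<open>e\<close> is treated alike: rotated into closing position, it
    leaves a walk between its own endpoints.\<close>
  have "2 * w e \<le> total_weight w C" if "e \<in> edges C" for e
  proof -
    obtain n where n: "e = {last (rotate n xs), hd (rotate n xs)}"
      using closed_pairs_eq_rotated_closing_pair \<open>e \<in> edges C\<close> xs by (metis list.size(3) not_numeral_le_zero)
    define ys where "ys = rotate n xs"
    have ys: "3 \<le> length ys" "distinct ys" "verts C = set ys" "edges C = closed_pairs ys"
      using xs by (simp_all add: ys_def closed_pairs_rotate)
    have e: "e = {last ys, hd ys}"
      using n by (simp add: ys_def)
    have "ys \<noteq> []"
      using ys(1) by auto
    then have "walk G (hd ys) (last ys) ys"
      using assms(2) ys by (auto simp: walk_def subgraph_def closed_pairs_def)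
    then have "d (hd ys) (last ys) \<le> walk_weight w ys"
      using pseudometric_le_walk_weight[OF d] by blast
    moreover have "d (hd ys) (last ys) = w e"
      using d(2)[of "hd ys" "last ys"] assms(2) that by (auto simp: subgraph_def e insert_commute)
    moreover have "total_weight w C = w e + walk_weight w ys"
      using closing_pair_notin_consecutive_pairs[OF ys(1,2)] sum_consecutive_pairs[OF ys(2)]
      by (simp add: total_weight_def ys(4) closed_pairs_def e)
    ultimately show ?thesis
      by simp
  qed
  \<comment> \<open>On a finite nonempty set \<open>Max\<close> is attained, so the bound for single
    edges applies to it.\<close>
  moreover have "finite (edges C)" "edges C \<noteq> {}"
    by (simp_all add: xs closed_pairs_def)
  then have "Max (w ` edges C) \<in> w ` edges C"
    by (intro Max_in) auto
  ultimately show ?thesis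
    by auto
qed

section \<open>Closing a path by an edge: (iii) implies (ii)\<close>

lemma cycle_inequality_imp_path_dist_extends:
  assumes w: "weighted_graph G w"
    and cyc: "\<And>C. subgraph C G \<Longrightarrow> cycle C \<Longrightarrow> 2 * Max (w ` edges C) \<le> total_weight w C"
    and e: "{u, v} \<in> edges G"
  shows "w {u, v} = path_dist G w u v"
proof (rule antisym)
  show "path_dist G w u v \<le> w {u, v}"
    using path_dist_le_walk_weight[OF w walk_edge[OF w e]] by simp
  show "w {u, v} \<le> path_dist G w u v"
  proof (rule path_dist_greatest[OF w walk_edge[OF w e]])
    fix xs assume xs: "walk G u v xs" "distinct xs"
    have "card {u, v} = 2"
      using w e by (auto simp: weighted_graph_def simple_graph_def)
    then have "u \<noteq> v"
      by auto
    show "w {u, v} \<le> walk_weight w xs"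
    proof (cases "3 \<le> length xs")
      case True
      let ?C = "(set xs, closed_pairs xs)"
      have e': "{last xs, hd xs} = {u, v}"
        using xs by (auto simp: walk_def)
      have sub: "closed_pairs xs \<subseteq> edges G"
        using xs e e' by (auto simp: closed_pairs_def walk_def)
      have "a \<subseteq> set xs" if "a \<in> closed_pairs xs" for a
        using that consecutive_pairs_subset[of a xs] xs(1) by (auto simp: closed_pairs_def walk_def)
      then have "subgraph ?C G"
        using sub w xs(1) by (auto simp: subgraph_def simple_graph_def weighted_graph_def walk_def)
      moreover have "cycle ?C"
        using True xs(2) by (auto simp: cycle_def closed_pairs_def)
      ultimately have "2 * Max (w ` closed_pairs xs) \<le> total_weight w ?C"
        using cyc by fastforce
      moreover have "w {u, v} \<le> Max (w ` closed_pairs xs)"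
        by (rule Max_ge) (auto simp: closed_pairs_def e')
      \<comment> \<open>The edge is counted once in the cycle and twice on the left of (iii), so one
        copy cancels.\<close>
      moreover have "total_weight w ?C = w {u, v} + walk_weight w xs"
        using closing_pair_notin_consecutive_pairs[OF True xs(2)] sum_consecutive_pairs[OF xs(2)]
        by (simp add: total_weight_def closed_pairs_def e')
      ultimately show ?thesis
        by simp
    next
      case False
      \<comment> \<open>With fewer than three vertices no cycle arises; \<open>u \<noteq> v\<close>
        excludes the one-vertex path, which leaves the edge itself.\<close>
      then have "xs = [u, v]"
        using xs \<open>u \<noteq> v\<close> by (cases xs; cases "tl xs"; cases "tl (tl xs)") (auto simp: walk_def split: if_splits)
      then show ?thesis
        by simp
    qed
  qed
qed

theorem theorem2p1:
  fixes G :: "'a graph" and w :: "'a set \<Rightarrow> real"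
  assumes "weighted_graph G w"
  shows "(metrizable G w \<longleftrightarrow> (\<forall>u v. {u, v} \<in> edges G \<longrightarrow> w {u, v} = path_dist G w u v)) \<and>
         ((\<forall>u v. {u, v} \<in> edges G \<longrightarrow> w {u, v} = path_dist G w u v) \<longleftrightarrow>
          (\<forall>C. subgraph C G \<and> cycle C \<longrightarrow> 2 * Max (w ` edges C) \<le> total_weight w C))"
proof (intro conjI iffI)
  assume m: "metrizable G w"
  show "\<forall>u v. {u, v} \<in> edges G \<longrightarrow> w {u, v} = path_dist G w u v"
    using cycle_inequality_imp_path_dist_extends[OF assms metrizable_imp_cycle_inequality[OF m]]
    by blast
next
  \<comment> \<open>Two goals start from (ii): (i) is obtained first, and (iii) then follows through
    it.\<close>
  assume "\<forall>u v. {u, v} \<in> edges G \<longrightarrow> w {u, v} = path_dist G w u v"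
  then show m: "metrizable G w"
    using metrizable_if_path_dist_extends[OF assms] by blast
  then show "\<forall>C. subgraph C G \<and> cycle C \<longrightarrow> 2 * Max (w ` edges C) \<le> total_weight w C"
    using metrizable_imp_cycle_inequality by blast
next
  assume "\<forall>C. subgraph C G \<and> cycle C \<longrightarrow> 2 * Max (w ` edges C) \<le> total_weight w C"
  then show "\<forall>u v. {u, v} \<in> edges G \<longrightarrow> w {u, v} = path_dist G w u v"
    using cycle_inequality_imp_path_dist_extends[OF assms] by blast
qed

end
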